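(* Consider a conservation law on a network, $u^k_t+f^k(u^k)_x=0$ for $x\in D^k$, $k\in\mathcal{I}$, with strictly increasing continuous fluxes $f^k:\mathbb{R}\to\mathbb{R}$. Let $\mathcal{G}^0_{\mathrm{disc}}\subset\mathbb{R}^{N+1}$ denote the set of all discrete stationary solutions for the upwind method. Then the set $$\mathcal{G}_{\mathrm{disc}}=\big\{(c^{-N_{\mathrm{in}}},\dots,c^{-1},c^1,\dots,c^{N_{\mathrm{out}}}):\mathbf{c}\in\mathcal{G}^0_{\mathrm{disc}}\big\}\subset\mathbb{R}^N$$ is a mutually consistent, maximal set of stationary solutions.
   Context: **Network.** Fix integers $N_{\mathrm{in}},N_{\mathrm{out}}\geq1$, $N=N_{\mathrm{in}}+N_{\mathrm{out}}$, $\mathcal{I}_{\mathrm{in}}=\{-N_{\mathrm{in}},\dots,-1\}$, $\mathcal{I}_{\mathrm{out}}=\{1,\dots,N_{\mathrm{out}}\}$, $\mathcal{I}=\mathcal{I}_{\mathrm{in}}\cup\mathcal{I}_{\mathrm{out}}$. $D^k=(-\infty,0)$ for $k\in\mathcal{I}_{\mathrm{in}}$, $D^k=(0,\infty)$ for $k\in\mathcal{I}_{\mathrm{out}}$. **Stationary solutions.** Vectors $\mathbf{c}=(c^k)_{k\in\mathcal{I}}\in\mathbb{R}^N$ with $\sum_{k\in\mathcal{I}_{\mathrm{in}}}f^k(c^k)=\sum_{k\in\mathcal{I}_{\mathrm{out}}}f^k(c^k)$. **Discrete stationary solutions (upwind method, increasing fluxes).** The upwind numerical flux is $F^k(u,v)=f^k(u)$.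 A discrete stationary solution is a vector $\mathbf{c}=(c^{-N_{\mathrm{in}}},\dots,c^{-1},c^0,c^1,\dots,c^{N_{\mathrm{out}}})\in\mathbb{R}^{N+1}$ with $\sum_{k\in\mathcal{I}_{\mathrm{in}}}f^k(c^k)=\sum_{k\in\mathcal{I}_{\mathrm{out}}}f^k(c^k)$, $F^k(c^k,c^0)=f^k(c^k)$ for $k\in\mathcal{I}_{\mathrm{in}}$ and $F^k(c^0,c^k)=f^k(c^k)$ for $k\in\mathcal{I}_{\mathrm{out}}$. **Mutual consistency, maximality.** With $q^k_c(u)=\operatorname{sgn}(u-c)(f^k(u)-f^k(c))$, a set $\mathcal{G}\subset\mathbb{R}^N$ of stationary solutions is mutually consistent if $\sum_{k\in\mathcal{I}_{\mathrm{in}}}q^k_{c^k}(\tilde c^k)\geq\sum_{k\in\mathcal{I}_{\mathrm{out}}}q^k_{c^k}(\tilde c^k)$ for all $\mathbf{c},\tilde{\mathbf{c}}\in\mathcal{G}$. It is maximal if no mutually consistent set of stationary solutions has $\mathcal{G}$ as a strict subset. *)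

theory Defs
  imports "HOL-Analysis.Analysis"
begin

text \<open>
  Edges are integers: negative labels are ingoing, positive labels are outgoing, and the label 0
  is the central node carrying the additional component of a discrete stationary solution.
  A vector indexed by a finite set of labels is an extensional function on that set, so that the
  vectors over \<open>A\<close> are exactly the elements of \<open>A \<rightarrow>\<^sub>E UNIV\<close> and two vectors are equal
  iff they have the same components.
\<close>

definition in_edges :: "nat \<Rightarrow> int set" where
  "in_edges N_in = {- int N_in .. -1}"

definition out_edges :: "nat \<Rightarrow> int set" where
  "out_edges N_out = {1 .. int N_out}"

definition edges :: "nat \<Rightarrow> nat \<Rightarrow> int set" where
  "edges N_in N_out = in_edges N_in \<union> out_edges N_out"

definition stationary_solutions ::
    "nat \<Rightarrow> nat \<Rightarrow> (int \<Rightarrow> real \<Rightarrow> real) \<Rightarrow> (int \<Rightarrow> real) set" where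
  "stationary_solutions N_in N_out f =
    {c \<in> edges N_in N_out \<rightarrow>\<^sub>E (UNIV :: real set).
      (\<Sum>k\<in>in_edges N_in. f k (c k)) = (\<Sum>k\<in>out_edges N_out. f k (c k))}"

definition discrete_stationary_solutions ::
    "nat \<Rightarrow> nat \<Rightarrow> (int \<Rightarrow> real \<Rightarrow> real) \<Rightarrow> (int \<Rightarrow> real \<Rightarrow> real \<Rightarrow> real)
      \<Rightarrow> (int \<Rightarrow> real) set" where
  "discrete_stationary_solutions N_in N_out f F =
    {c \<in> insert 0 (edges N_in N_out) \<rightarrow>\<^sub>E (UNIV :: real set).
      (\<Sum>k\<in>in_edges N_in. f k (c k)) = (\<Sum>k\<in>out_edges N_out. f k (c k)) \<and>
      (\<forall>k\<in>in_edges N_in. F k (c k) (c 0) = f k (c k)) \<and>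
      (\<forall>k\<in>out_edges N_out. F k (c 0) (c k) = f k (c k))}"

text \<open>The upwind flux in this form is the one for increasing fluxes \<open>f k\<close>.\<close>

definition upwind_flux :: "(int \<Rightarrow> real \<Rightarrow> real) \<Rightarrow> int \<Rightarrow> real \<Rightarrow> real \<Rightarrow> real" where
  "upwind_flux f k u v = f k u"

definition G_disc ::
    "nat \<Rightarrow> nat \<Rightarrow> (int \<Rightarrow> real \<Rightarrow> real) \<Rightarrow> (int \<Rightarrow> real \<Rightarrow> real \<Rightarrow> real)
      \<Rightarrow> (int \<Rightarrow> real) set" where
  "G_disc N_in N_out f F =
    (\<lambda>c. restrict c (edges N_in N_out)) ` discrete_stationary_solutions N_in N_out f F"

text \<open>The Kruzkov entropy flux \<open>q\<^sup>k\<^sub>c(u)\<close> is written \<open>entropy_flux f k c u\<close>.\<close>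

definition entropy_flux :: "(int \<Rightarrow> real \<Rightarrow> real) \<Rightarrow> int \<Rightarrow> real \<Rightarrow> real \<Rightarrow> real" where
  "entropy_flux f k c u = sgn (u - c) * (f k u - f k c)"

definition mutually_consistent ::
    "nat \<Rightarrow> nat \<Rightarrow> (int \<Rightarrow> real \<Rightarrow> real) \<Rightarrow> (int \<Rightarrow> real) set \<Rightarrow> bool" where
  "mutually_consistent N_in N_out f G \<longleftrightarrow>
    (\<forall>c\<in>G. \<forall>c'\<in>G.
      (\<Sum>k\<in>in_edges N_in. entropy_flux f k (c k) (c' k)) \<ge>
      (\<Sum>k\<in>out_edges N_out. entropy_flux f k (c k) (c' k)))"

definition maximal_consistent ::
    "nat \<Rightarrow> nat \<Rightarrow> (int \<Rightarrow> real \<Rightarrow> real) \<Rightarrow> (int \<Rightarrow> real) set \<Rightarrow> bool" where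
  "maximal_consistent N_in N_out f G \<longleftrightarrow>
    \<not> (\<exists>H. H \<subseteq> stationary_solutions N_in N_out f \<and>
          mutually_consistent N_in N_out f H \<and> G \<subset> H)"

end

(* The upwind flux forces all outgoing components to equal the node value, so the reduced set
   consists of the stationary solutions that are constant on the outgoing edges. For increasing
   fluxes the Kruzkov flux is |f(u) - f(c)|, and since the outgoing differences of two such
   solutions all have the same sign, mutual consistency is the triangle inequality.
   For maximality, given a stationary d that is consistent with the set, the intermediate value
   theorem yields a value a with sum f(a) = sum f(d) over the outgoing edges. Replacing the
   outgoing components of d by a gives an element of the set with the same ingoing components, so
   the entropy inequality against d reads 0 >= sum |f(d) - f(a)|, whence d is already constant
   on the outgoing edges. *)

theory Submission
  imports Defs
begin

lemma finite_in_edges [simp]: "finite (in_edges m)"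
  and finite_out_edges [simp]: "finite (out_edges n)"
  by (simp_all add: in_edges_def out_edges_def)

lemma entropy_flux_strict_mono:
  assumes "strict_mono (f k)"
  shows "entropy_flux f k c u = \<bar>f k u - f k c\<bar>"
  using strict_monoD[OF assms, of u c] strict_monoD[OF assms, of c u]
  by (cases u c rule: linorder_cases) (auto simp: entropy_flux_def)

text \<open>On an ingoing edge the flux condition is the identity
  \<open>f k (c k) = f k (c k)\<close>. On an outgoing edge it reads
  \<open>f k (c 0) = f k (c k)\<close>, which injectivity turns into
  \<open>c k = c 0\<close>.\<close>

lemma G_disc_upwind:
  assumes "\<And>k. k \<in> edges m n \<Longrightarrow> inj (f k)"
  shows "G_disc m n f (upwind_flux f) =
    {c \<in> stationary_solutions m n f. \<exists>a. \<forall>k\<in>out_edges n. c k = a}"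
    (is "?G = ?S")
proof (intro equalityI subsetI)
  have edges: "k \<in> edges m n" if "k \<in> in_edges m \<or> k \<in> out_edges n" for k
    using that by (auto simp: edges_def)
  fix d
  {
    assume "d \<in> ?G"
    then obtain c where c: "c \<in> discrete_stationary_solutions m n f (upwind_flux f)"
      and d: "d = restrict c (edges m n)"
      by (auto simp: G_disc_def)
    have "c k = c 0" if "k \<in> out_edges n" for k
      using c that injD[OF assms, of k "c 0" "c k"]
      by (auto simp: discrete_stationary_solutions_def upwind_flux_def edges)
    then show "d \<in> ?S"
      using c d by (auto simp: discrete_stationary_solutions_def stationary_solutions_def edges)
  }
  assume "d \<in> ?S"
  then obtain a where d: "d \<in> stationary_solutions m n f"
    and a: "\<And>k. k \<in> out_edges n \<Longrightarrow> d k = a"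
    by blast
  have d_ext: "d \<in> extensional (edges m n)"
    using d by (auto simp: stationary_solutions_def PiE_def)
  \<comment> \<open>As 0 labels no edge, the update at 0 changes neither sum, and
    \<open>restrict\<close> undoes it because \<open>d\<close> is extensional.\<close>
  have not0: "k \<noteq> 0" if "k \<in> edges m n" for k
    using that by (auto simp: edges_def in_edges_def out_edges_def)
  have sums: "(\<Sum>k\<in>in_edges m. f k ((d(0 := a)) k)) = (\<Sum>k\<in>in_edges m. f k (d k))"
    "(\<Sum>k\<in>out_edges n. f k ((d(0 := a)) k)) = (\<Sum>k\<in>out_edges n. f k (d k))"
    by (auto intro!: sum.cong dest: not0[OF edges, OF disjI1] not0[OF edges, OF disjI2])
  \<comment> \<open>With the common outgoing value at the node, each outgoing flux condition becomes
    \<open>f k a = f k a\<close>.\<close>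
  have "d(0 := a) \<in> discrete_stationary_solutions m n f (upwind_flux f)"
    unfolding discrete_stationary_solutions_def mem_Collect_eq sums
    using d d_ext a not0 edges
    by (auto simp: stationary_solutions_def upwind_flux_def extensional_def PiE_def)
  moreover have "restrict (d(0 := a)) (edges m n) = d"
    using d_ext not0 by (auto simp: restrict_def extensional_def fun_eq_iff)
  ultimately show "d \<in> ?G"
    unfolding G_disc_def by (metis image_eqI)
qed

text \<open>All \<open>d k\<close> lie between their minimum and maximum over \<open>A\<close>, so
  by monotonicity the sums at these two arguments enclose the target value, and the intermediate
  value theorem applies.\<close>

lemma exists_common_argument_sum:
  fixes g :: "'i \<Rightarrow> real \<Rightarrow> real"
  assumes "finite A" and "A \<noteq> {}"
    and mono: "\<And>k. k \<in> A \<Longrightarrow> mono (g k)"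
    and cont: "\<And>k. k \<in> A \<Longrightarrow> continuous_on UNIV (g k)"
  shows "\<exists>a. (\<Sum>k\<in>A. g k a) = (\<Sum>k\<in>A. g k (d k))"
proof -
  let ?l = "Min (d ` A)" and ?u = "Max (d ` A)"
  have "\<exists>a\<ge>?l. a \<le> ?u \<and> (\<Sum>k\<in>A. g k a) = (\<Sum>k\<in>A. g k (d k))"
  proof (rule IVT')
    show "(\<Sum>k\<in>A. g k ?l) \<le> (\<Sum>k\<in>A. g k (d k))"
      using assms(1) by (intro sum_mono monoD[OF mono]) auto
    show "(\<Sum>k\<in>A. g k (d k)) \<le> (\<Sum>k\<in>A. g k ?u)"
      using assms(1) by (intro sum_mono monoD[OF mono]) auto
    show "?l \<le> ?u"
      using assms(1,2) by simp
    show "continuous_on {?l..?u} (\<lambda>a. \<Sum>k\<in>A. g k a)"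
      by (intro continuous_on_sum continuous_on_subset[OF cont]) auto
  qed
  then show ?thesis by blast
qed

text \<open>The order of \<open>a\<close> and \<open>b\<close> fixes one sign for all the
  differences, so no cancellation occurs in the sum.\<close>

lemma sum_abs_diff_const_mono:
  fixes g :: "'i \<Rightarrow> real \<Rightarrow> real"
  assumes "\<And>k. k \<in> A \<Longrightarrow> mono (g k)"
  shows "(\<Sum>k\<in>A. \<bar>g k b - g k a\<bar>) = \<bar>\<Sum>k\<in>A. g k b - g k a\<bar>"
proof (induction a b rule: linorder_wlog)
  case (le a b)
  then have "g k a \<le> g k b" if "k \<in> A" for k
    using that assms monoD by blast
  then show ?case
    by (simp add: sum_nonneg)
next
  case (sym a b)
  then show ?case
    by (simp add: abs_minus_commute sum_subtractf)
qed

theorem proposition6p2: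
  fixes N_in N_out :: nat and f :: "int \<Rightarrow> real \<Rightarrow> real"
  assumes "N_in \<ge> 1" and "N_out \<ge> 1"
    and "\<And>k. k \<in> edges N_in N_out \<Longrightarrow> strict_mono (f k)"
    and "\<And>k. k \<in> edges N_in N_out \<Longrightarrow> continuous_on UNIV (f k)"
  shows "G_disc N_in N_out f (upwind_flux f) \<subseteq> stationary_solutions N_in N_out f \<and>
    mutually_consistent N_in N_out f (G_disc N_in N_out f (upwind_flux f)) \<and>
    maximal_consistent N_in N_out f (G_disc N_in N_out f (upwind_flux f))"
proof -
  let ?I = "in_edges N_in" and ?O = "out_edges N_out"
  let ?S = "stationary_solutions N_in N_out f"
  let ?G = "G_disc N_in N_out f (upwind_flux f)"
  have G: "?G = {c \<in> ?S. \<exists>a. \<forall>k\<in>?O. c k = a}"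
    using assms(3) by (intro G_disc_upwind strict_mono_imp_inj_on)
  have smI: "strict_mono (f k)" if "k \<in> ?I" for k
    using that assms(3) by (simp add: edges_def)
  have smO: "strict_mono (f k)" if "k \<in> ?O" for k
    using that assms(3) by (simp add: edges_def)
  have flux: "(\<Sum>k\<in>?I. entropy_flux f k (c k) (d k)) = (\<Sum>k\<in>?I. \<bar>f k (d k) - f k (c k)\<bar>)"
    "(\<Sum>k\<in>?O. entropy_flux f k (c k) (d k)) = (\<Sum>k\<in>?O. \<bar>f k (d k) - f k (c k)\<bar>)" for c d
    by (simp_all add: entropy_flux_strict_mono smI smO cong: sum.cong)
  have balance: "(\<Sum>k\<in>?I. f k (c k)) = (\<Sum>k\<in>?O. f k (c k))" if "c \<in> ?S" for c
    using that by (simp add: stationary_solutions_def)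
  have "mutually_consistent N_in N_out f ?G"
    unfolding mutually_consistent_def flux
  proof (intro ballI)
    fix c d assume "c \<in> ?G" "d \<in> ?G"
    then obtain a b where S: "c \<in> ?S" "d \<in> ?S"
      and ab: "\<And>k. k \<in> ?O \<Longrightarrow> c k = a" "\<And>k. k \<in> ?O \<Longrightarrow> d k = b"
      unfolding G by blast
    have "(\<Sum>k\<in>?O. \<bar>f k (d k) - f k (c k)\<bar>) = (\<Sum>k\<in>?O. \<bar>f k b - f k a\<bar>)"
      using ab by simp
    also have "\<dots> = \<bar>\<Sum>k\<in>?O. f k b - f k a\<bar>"
      using smO by (intro sum_abs_diff_const_mono strict_mono_mono)
    also have "\<dots> = \<bar>\<Sum>k\<in>?O. f k (d k) - f k (c k)\<bar>"
      using ab by simp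
    \<comment> \<open>Stationarity of both \<open>c\<close> and \<open>d\<close> carries the net
      difference across the node.\<close>
    also have "\<dots> = \<bar>\<Sum>k\<in>?I. f k (d k) - f k (c k)\<bar>"
      using balance[OF S(1)] balance[OF S(2)] by (simp add: sum_subtractf)
    also have "\<dots> \<le> (\<Sum>k\<in>?I. \<bar>f k (d k) - f k (c k)\<bar>)"
      by (rule sum_abs)
    finally show "(\<Sum>k\<in>?O. \<bar>f k (d k) - f k (c k)\<bar>) \<le> (\<Sum>k\<in>?I. \<bar>f k (d k) - f k (c k)\<bar>)" .
  qed
  \<comment> \<open>This inclusion excludes every strict consistent extension of
    \<open>?G\<close>.\<close>
  moreover have "H \<subseteq> ?G"
    if H: "H \<subseteq> ?S" "mutually_consistent N_in N_out f H" "?G \<subseteq> H" for H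
  proof
    fix d assume d: "d \<in> H"
    have "\<exists>a. (\<Sum>k\<in>?O. f k a) = (\<Sum>k\<in>?O. f k (d k))"
      using assms(2,4) smO
      by (intro exists_common_argument_sum strict_mono_mono) (auto simp: edges_def out_edges_def)
    then obtain a where a: "(\<Sum>k\<in>?O. f k a) = (\<Sum>k\<in>?O. f k (d k))"
      by blast
    \<comment> \<open>Off the outgoing edges \<open>c\<close> copies \<open>d\<close>, also outside
      all edges, so it stays extensional; the choice of \<open>a\<close> preserves the
      balance.\<close>
    define c where "c k = (if k \<in> ?O then a else d k)" for k
    have cI: "c k = d k" if "k \<in> ?I" for k
      using that by (auto simp: c_def in_edges_def out_edges_def)
    have cO: "c k = a" if "k \<in> ?O" for k
      using that by (simp add: c_def)
    have "d \<in> ?S"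
      using d H(1) by blast
    then have "c \<in> ?S"
      using a balance[of d] cI cO
      by (auto simp: stationary_solutions_def PiE_def extensional_def c_def edges_def)
    then have "c \<in> H"
      using cO H(3) unfolding G by blast
    \<comment> \<open>Consistency of \<open>H\<close> is used with \<open>c\<close> as the reference
      state and \<open>d\<close> as the argument.\<close>
    then have "(\<Sum>k\<in>?O. \<bar>f k (d k) - f k (c k)\<bar>) \<le> (\<Sum>k\<in>?I. \<bar>f k (d k) - f k (c k)\<bar>)"
      using H(2) d unfolding mutually_consistent_def flux by blast
    also have "\<dots> = 0"
      using cI by simp
    finally have "(\<Sum>k\<in>?O. \<bar>f k (d k) - f k (c k)\<bar>) = 0"
      by (simp add: order_antisym sum_nonneg)
    then have "f k (d k) = f k a" if "k \<in> ?O" for k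
      using that cO by (simp add: sum_nonneg_eq_0_iff)
    then have "d k = a" if "k \<in> ?O" for k
      using that strict_mono_eq[OF smO] by blast
    then show "d \<in> ?G"
      unfolding G using \<open>d \<in> ?S\<close> by blast
  qed
  ultimately show ?thesis
    unfolding maximal_consistent_def using G by blast
qed

end
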